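(* Let $A$ be a Banach algebra and let $B$ be a right Banach $A$-module with action $\pi_r:B\times A\to B$, having a bounded right approximate identity (RBAI) $(e_\alpha)_\alpha\subseteq A$. Then: (1) $B$ factors on the left, i.e. $B=BA$. (2) Suppose $Z_{A^{**}}(B^{**})=B^{**}$. If $A^*$ factors on the right, then $B^*$ factors on the right, i.e. $AB^*=B^*$.
   Context: An RBAI for $B$ is a bounded net $(e_\alpha)$ in $A$ which is a right approximate identity for $A$ ($ae_\alpha\to a$ for all $a\in A$) and satisfies $be_\alpha\to b$ for all $b\in B$. For $a\in A$, $b'\in B^*$, $ab'\in B^*$ is defined by $\langle ab',b\rangle=\langle b',ba\rangle$, and $AB^*=\{ab'\}$; similarly $\langle aa',x\rangle=\langle a',xa\rangle$ for $a'\in A^*$, $AA^*=\{aa'\}$. "$A^*$ factors on the right" means that $A$ has a bounded approximate identity and $AA^*=A^*$. The map $\pi_r^{***}:B^{**}\times A^{**}\to B^{**}$ is defined by $\langle\pi_r^*(b',b),a\rangle=\langle b',ba\rangle$, $\langle\pi_r^{**}(a'',b'),b\rangle=\langle a'',\pi_r^*(b',b)\rangle$, $\langle\pi_r^{***}(b'',a''),b'\rangle=\langle b'',\pi_r^{**}(a'',b')\rangle$. $Z_{A^{**}}(B^{**})=\{b''\in B^{**}: a''\mapsto\pi_r^{***}(b'',a'')\text{ is weak}^*\text{-to-weak}^*\text{ continuous from }A^{**}\text{ to }B^{**}\}$. *)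

theory Defs
  imports "HOL-Analysis.Analysis"
begin

text \<open>
  Scalars range over a type of sorts \<open>real_normed_field\<close> and \<open>euclidean_space\<close>. The instances
  are \<open>real\<close> and \<open>complex\<close>, so real and complex Banach algebras are covered uniformly.
  Scalar multiplication over \<open>'k\<close> is an explicit parameter extending \<open>scaleR\<close>.
\<close>

definition normed_scaling ::
    "('k::{real_normed_field,euclidean_space} \<Rightarrow> 'v::real_normed_vector \<Rightarrow> 'v) \<Rightarrow> bool" where
  "normed_scaling s \<longleftrightarrow>
     vector_space s \<and> (\<forall>r x. s (of_real r) x = r *\<^sub>R x) \<and> (\<forall>c x. norm (s c x) = norm c * norm x)"

definition banach_algebra ::
    "('k::{real_normed_field,euclidean_space} \<Rightarrow> 'a::{banach,real_normed_algebra} \<Rightarrow> 'a) \<Rightarrow> bool" where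
  "banach_algebra s \<longleftrightarrow>
     normed_scaling s \<and> (\<forall>c x y. s c x * y = s c (x * y) \<and> x * s c y = s c (x * y))"

definition right_banach_module ::
    "('k::{real_normed_field,euclidean_space} \<Rightarrow> 'a::{banach,real_normed_algebra} \<Rightarrow> 'a) \<Rightarrow>
     ('k \<Rightarrow> 'b::banach \<Rightarrow> 'b) \<Rightarrow> ('b \<Rightarrow> 'a \<Rightarrow> 'b) \<Rightarrow> bool" where
  "right_banach_module sA sB act \<longleftrightarrow>
     normed_scaling sB \<and> bounded_bilinear act \<and>
     (\<forall>c b a. act (sB c b) a = sB c (act b a) \<and> act b (sA c a) = sB c (act b a)) \<and>
     (\<forall>b x y. act (act b x) y = act b (x * y))"

subsection \<open>Duals and biduals\<close>

text \<open>The \<open>'k\<close>-linear dual, as a subset of the bounded \<open>real\<close>-linear maps into \<open>'k\<close>.\<close>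

definition dual ::
    "('k::{real_normed_field,euclidean_space} \<Rightarrow> 'v::real_normed_vector \<Rightarrow> 'v) \<Rightarrow> ('v \<Rightarrow>\<^sub>L 'k) set" where
  "dual s = {f. \<forall>c x. blinfun_apply f (s c x) = c * blinfun_apply f x}"

text \<open>Elements of the bidual are functions on \<^term>\<open>dual s\<close>, made unique by extensionality.\<close>

definition bidual ::
    "('k::{real_normed_field,euclidean_space} \<Rightarrow> 'v::real_normed_vector \<Rightarrow> 'v) \<Rightarrow>
     (('v \<Rightarrow>\<^sub>L 'k) \<Rightarrow> 'k) set" where
  "bidual s = {\<Phi> \<in> extensional (dual s).
     (\<forall>f\<in>dual s. \<forall>g\<in>dual s. \<Phi> (f + g) = \<Phi> f + \<Phi> g) \<and>
     (\<forall>c. \<forall>f\<in>dual s. \<Phi> (blinfun_mult_right c o\<^sub>L f) = c * \<Phi> f) \<and>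
     (\<exists>K. \<forall>f\<in>dual s. norm (\<Phi> f) \<le> K * norm f)}"

definition weak_star_bidual ::
    "('k::{real_normed_field,euclidean_space} \<Rightarrow> 'v::real_normed_vector \<Rightarrow> 'v) \<Rightarrow>
     (('v \<Rightarrow>\<^sub>L 'k) \<Rightarrow> 'k) topology" where
  "weak_star_bidual s = subtopology (product_topology (\<lambda>_. euclidean) (dual s)) (bidual s)"

subsection \<open>Dual actions and the extension of the module action\<close>

text \<open>
  The arguments of \<open>Blinfun\<close> below are bounded linear for a bounded bilinear action, as the
  \<open>_apply\<close> lemmas record.
\<close>

definition dual_lact ::
    "('b \<Rightarrow> 'a \<Rightarrow> 'b) \<Rightarrow> 'a::real_normed_vector \<Rightarrow>
     ('b::real_normed_vector \<Rightarrow>\<^sub>L 'k::{real_normed_field,euclidean_space}) \<Rightarrow> ('b \<Rightarrow>\<^sub>L 'k)" where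
  "dual_lact act a f = Blinfun (\<lambda>b. blinfun_apply f (act b a))"

definition act_star ::
    "('b \<Rightarrow> 'a \<Rightarrow> 'b) \<Rightarrow> ('b::real_normed_vector \<Rightarrow>\<^sub>L 'k::{real_normed_field,euclidean_space}) \<Rightarrow>
     'b \<Rightarrow> ('a::real_normed_vector \<Rightarrow>\<^sub>L 'k)" where
  "act_star act f b = Blinfun (\<lambda>a. blinfun_apply f (act b a))"

definition act_star2 ::
    "('b \<Rightarrow> 'a \<Rightarrow> 'b) \<Rightarrow> (('a::real_normed_vector \<Rightarrow>\<^sub>L 'k::{real_normed_field,euclidean_space}) \<Rightarrow> 'k) \<Rightarrow>
     ('b::real_normed_vector \<Rightarrow>\<^sub>L 'k) \<Rightarrow> ('b \<Rightarrow>\<^sub>L 'k)" where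
  "act_star2 act \<Phi> f = Blinfun (\<lambda>b. \<Phi> (act_star act f b))"

definition act_star3 ::
    "('k \<Rightarrow> 'b \<Rightarrow> 'b) \<Rightarrow> ('b \<Rightarrow> 'a \<Rightarrow> 'b) \<Rightarrow>
     (('b::real_normed_vector \<Rightarrow>\<^sub>L 'k::{real_normed_field,euclidean_space}) \<Rightarrow> 'k) \<Rightarrow>
     (('a::real_normed_vector \<Rightarrow>\<^sub>L 'k) \<Rightarrow> 'k) \<Rightarrow> (('b \<Rightarrow>\<^sub>L 'k) \<Rightarrow> 'k)" where
  "act_star3 sB act \<Psi> \<Phi> = (\<lambda>f\<in>dual sB. \<Psi> (act_star2 act \<Phi> f))"

definition module_center ::
    "('k::{real_normed_field,euclidean_space} \<Rightarrow> 'a::real_normed_vector \<Rightarrow> 'a) \<Rightarrow>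
     ('k \<Rightarrow> 'b::real_normed_vector \<Rightarrow> 'b) \<Rightarrow> ('b \<Rightarrow> 'a \<Rightarrow> 'b) \<Rightarrow> (('b \<Rightarrow>\<^sub>L 'k) \<Rightarrow> 'k) set" where
  "module_center sA sB act =
     {\<Psi> \<in> bidual sB. continuous_map (weak_star_bidual sA) (weak_star_bidual sB) (act_star3 sB act \<Psi>)}"

subsection \<open>Approximate identities and factorization\<close>

text \<open>A net is rendered as a map \<open>e\<close> on an index type with a proper filter of tails \<open>F\<close>.\<close>

definition is_RAI :: "('i \<Rightarrow> 'a::real_normed_algebra) \<Rightarrow> 'i filter \<Rightarrow> bool" where
  "is_RAI e F \<longleftrightarrow> (\<forall>a. ((\<lambda>i. a * e i) \<longlongrightarrow> a) F)"

definition is_LAI :: "('i \<Rightarrow> 'a::real_normed_algebra) \<Rightarrow> 'i filter \<Rightarrow> bool" where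
  "is_LAI e F \<longleftrightarrow> (\<forall>a. ((\<lambda>i. e i * a) \<longlongrightarrow> a) F)"

definition is_RBAI ::
    "('b::real_normed_vector \<Rightarrow> 'a \<Rightarrow> 'b) \<Rightarrow> ('i \<Rightarrow> 'a::real_normed_algebra) \<Rightarrow> 'i filter \<Rightarrow> bool" where
  "is_RBAI act e F \<longleftrightarrow>
     F \<noteq> bot \<and> Bfun e F \<and> is_RAI e F \<and> (\<forall>b. ((\<lambda>i. act b (e i)) \<longlongrightarrow> b) F)"

text \<open>
  Quantifying over filters on the algebra itself loses no generality: a net \<open>e\<close> along \<open>F\<close> may be
  replaced by the identity along \<open>filtermap e F\<close>.
\<close>

definition has_BAI :: "'a::real_normed_algebra itself \<Rightarrow> bool" where
  "has_BAI _ \<longleftrightarrow> (\<exists>F :: 'a filter.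
     F \<noteq> bot \<and> Bfun (\<lambda>x. x) F \<and> is_LAI (\<lambda>x. x) F \<and> is_RAI (\<lambda>x. x) F)"

definition module_factors_left :: "('b \<Rightarrow> 'a \<Rightarrow> 'b) \<Rightarrow> bool" where
  "module_factors_left act \<longleftrightarrow> {act b a | b a. True} = UNIV"

definition dual_factors_right ::
    "('k::{real_normed_field,euclidean_space} \<Rightarrow> 'b::real_normed_vector \<Rightarrow> 'b) \<Rightarrow>
     ('b \<Rightarrow> 'a::real_normed_vector \<Rightarrow> 'b) \<Rightarrow> bool" where
  "dual_factors_right sB act \<longleftrightarrow> {dual_lact act a f | a f. f \<in> dual sB} = dual sB"

definition algebra_dual_factors_right ::
    "('k::{real_normed_field,euclidean_space} \<Rightarrow> 'a::real_normed_algebra \<Rightarrow> 'a) \<Rightarrow> bool" where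
  "algebra_dual_factors_right sA \<longleftrightarrow> has_BAI TYPE('a) \<and> dual_factors_right sA (*)"

subsection \<open>Well-definedness\<close>

lemma dual_lact_apply:
  assumes "bounded_bilinear act"
  shows "blinfun_apply (dual_lact act a f) b = blinfun_apply f (act b a)"
  unfolding dual_lact_def
  by (subst bounded_linear_Blinfun_apply)
     (auto intro: bounded_linear_compose[OF blinfun.bounded_linear_right
         bounded_bilinear.bounded_linear_left[OF assms]])

lemma act_star_apply:
  assumes "bounded_bilinear act"
  shows "blinfun_apply (act_star act f b) a = blinfun_apply f (act b a)"
  unfolding act_star_def
  by (subst bounded_linear_Blinfun_apply)
     (auto intro: bounded_linear_compose[OF blinfun.bounded_linear_right
         bounded_bilinear.bounded_linear_right[OF assms]])

lemma act_star_mem_dual: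
  assumes "right_banach_module sA sB act" "f \<in> dual sB"
  shows "act_star act f b \<in> dual sA"
  using assms by (auto simp: right_banach_module_def dual_def act_star_apply)

lemma act_star_bound:
  assumes "bounded_bilinear act"
  shows "\<exists>K\<ge>0. \<forall>f b. norm (act_star act f b) \<le> K * norm f * norm b"
proof -
  obtain K where K: "K \<ge> 0" "\<And>b a. norm (act b a) \<le> norm b * norm a * K"
    using bounded_bilinear.nonneg_bounded[OF assms] by blast
  have "norm (act_star act f b) \<le> K * norm f * norm b" for f :: "'a \<Rightarrow>\<^sub>L 'k::{real_normed_field,euclidean_space}" and b
  proof (rule norm_blinfun_bound)
    show "0 \<le> K * norm f * norm b" using K by simp
    fix a
    have "norm (blinfun_apply f (act b a)) \<le> norm f * norm (act b a)" by (rule norm_blinfun)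
    also have "\<dots> \<le> norm f * (norm b * norm a * K)" by (intro mult_left_mono K) simp
    finally show "norm (blinfun_apply (act_star act f b) a) \<le> K * norm f * norm b * norm a"
      by (simp add: act_star_apply[OF assms] algebra_simps)
  qed
  with K show ?thesis by blast
qed

lemma act_star2_aux:
  assumes M: "right_banach_module sA sB act" and f: "f \<in> dual sB" and \<Phi>: "\<Phi> \<in> bidual sA"
  shows "bounded_linear (\<lambda>b. \<Phi> (act_star act f b))"
    and "\<Phi> (act_star act f (sB c b)) = c * \<Phi> (act_star act f b)"
proof -
  have bb: "bounded_bilinear act" using M by (simp add: right_banach_module_def)
  have ns: "\<And>r x. sB (of_real r) x = r *\<^sub>R x"
    using M by (simp add: right_banach_module_def normed_scaling_def)
  note mem = act_star_mem_dual[OF M f]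
  have add: "act_star act f (x + y) = act_star act f x + act_star act f y" for x y
    by (rule blinfun_eqI) (simp add: act_star_apply[OF bb] blinfun.add_left blinfun.add_right
        bounded_bilinear.add_left[OF bb])
  have sc: "act_star act f (sB c x) = blinfun_mult_right c o\<^sub>L act_star act f x" for c x
    using M f by (intro blinfun_eqI) (simp add: act_star_apply[OF bb] right_banach_module_def dual_def)
  have hom: "\<Phi> (act_star act f (sB c x)) = c * \<Phi> (act_star act f x)" for c x
    using \<Phi> mem by (simp add: sc bidual_def)
  then show "\<Phi> (act_star act f (sB c b)) = c * \<Phi> (act_star act f b)" .
  obtain K where K: "\<And>g. g \<in> dual sA \<Longrightarrow> norm (\<Phi> g) \<le> K * norm g"
    using \<Phi> unfolding bidual_def by blast
  obtain L where L: "L \<ge> 0" "\<And>b. norm (act_star act f b) \<le> L * norm f * norm b"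
    using act_star_bound[OF bb] by blast
  show "bounded_linear (\<lambda>b. \<Phi> (act_star act f b))"
  proof (rule bounded_linear_intro[where K="\<bar>K\<bar> * (L * norm f)"])
    show "\<Phi> (act_star act f (x + y)) = \<Phi> (act_star act f x) + \<Phi> (act_star act f y)" for x y
      using \<Phi> mem by (simp add: add bidual_def)
    show "\<Phi> (act_star act f (r *\<^sub>R x)) = r *\<^sub>R \<Phi> (act_star act f x)" for r x
      using hom[of "of_real r" x] by (simp add: ns scaleR_conv_of_real)
    show "norm (\<Phi> (act_star act f x)) \<le> norm x * (\<bar>K\<bar> * (L * norm f))" for x
    proof -
      have "norm (\<Phi> (act_star act f x)) \<le> \<bar>K\<bar> * norm (act_star act f x)"
        using K[OF mem, of x] by (meson abs_ge_self mult_right_mono norm_ge_zero order_trans)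
      also have "\<dots> \<le> \<bar>K\<bar> * (L * norm f * norm x)" by (intro mult_left_mono L) simp
      finally show ?thesis by (simp add: algebra_simps)
    qed
  qed
qed

lemma act_star2_apply:
  assumes "right_banach_module sA sB act" "f \<in> dual sB" "\<Phi> \<in> bidual sA"
  shows "blinfun_apply (act_star2 act \<Phi> f) b = \<Phi> (act_star act f b)"
  unfolding act_star2_def using act_star2_aux(1)[OF assms] by (simp add: bounded_linear_Blinfun_apply)

lemma act_star2_mem_dual:
  assumes "right_banach_module sA sB act" "f \<in> dual sB" "\<Phi> \<in> bidual sA"
  shows "act_star2 act \<Phi> f \<in> dual sB"
  by (simp add: dual_def act_star2_apply[OF assms] act_star2_aux(2)[OF assms])

lemma act_star3_mem_bidual:
  assumes M: "right_banach_module sA sB act" and \<Psi>: "\<Psi> \<in> bidual sB" and \<Phi>: "\<Phi> \<in> bidual sA"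
  shows "act_star3 sB act \<Psi> \<Phi> \<in> bidual sB"
proof -
  have bb: "bounded_bilinear act" using M by (simp add: right_banach_module_def)
  note ap = act_star2_apply[OF M _ \<Phi>] and mem = act_star2_mem_dual[OF M _ \<Phi>]
    and smem = act_star_mem_dual[OF M]
  have dadd: "f + g \<in> dual sB" if "f \<in> dual sB" "g \<in> dual sB" for f g
    using that by (simp add: dual_def blinfun.add_left algebra_simps)
  have dsc: "blinfun_mult_right c o\<^sub>L f \<in> dual sB" if "f \<in> dual sB" for f c
    using that by (simp add: dual_def)
  have sadd: "act_star act (f + g) b = act_star act f b + act_star act g b" for f g :: "'c \<Rightarrow>\<^sub>L 'a" and b
    by (rule blinfun_eqI) (simp add: act_star_apply[OF bb] blinfun.add_left)
  have ssc: "act_star act (blinfun_mult_right c o\<^sub>L f) b = blinfun_mult_right c o\<^sub>L act_star act f b"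
    for f :: "'c \<Rightarrow>\<^sub>L 'a" and b c
    by (rule blinfun_eqI) (simp add: act_star_apply[OF bb])
  have add2: "act_star2 act \<Phi> (f + g) = act_star2 act \<Phi> f + act_star2 act \<Phi> g"
    if "f \<in> dual sB" "g \<in> dual sB" for f g
    using that \<Phi> by (intro blinfun_eqI) (simp add: ap dadd blinfun.add_left sadd smem bidual_def)
  have sc2: "act_star2 act \<Phi> (blinfun_mult_right c o\<^sub>L f) = blinfun_mult_right c o\<^sub>L act_star2 act \<Phi> f"
    if "f \<in> dual sB" for f c
    using that \<Phi> by (intro blinfun_eqI) (simp add: ap dsc ssc smem bidual_def)
  obtain K where K: "\<And>g. g \<in> dual sB \<Longrightarrow> norm (\<Psi> g) \<le> K * norm g"
    using \<Psi> unfolding bidual_def by blast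
  obtain J where J: "\<And>g. g \<in> dual sA \<Longrightarrow> norm (\<Phi> g) \<le> J * norm g"
    using \<Phi> unfolding bidual_def by blast
  obtain L where L: "L \<ge> 0" "\<And>(f :: 'c \<Rightarrow>\<^sub>L 'a) b. norm (act_star act f b) \<le> L * norm f * norm b"
    using act_star_bound[OF bb] by blast
  have "norm (\<Psi> (act_star2 act \<Phi> f)) \<le> (\<bar>K\<bar> * \<bar>J\<bar> * L) * norm f" if f: "f \<in> dual sB" for f
  proof -
    have "norm (act_star2 act \<Phi> f) \<le> \<bar>J\<bar> * L * norm f"
    proof (rule norm_blinfun_bound)
      show "0 \<le> \<bar>J\<bar> * L * norm f" using L by simp
      fix b
      have "norm (\<Phi> (act_star act f b)) \<le> \<bar>J\<bar> * norm (act_star act f b)"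
        using J[OF smem[OF f], of b] by (meson abs_ge_self mult_right_mono norm_ge_zero order_trans)
      also have "\<dots> \<le> \<bar>J\<bar> * (L * norm f * norm b)" by (intro mult_left_mono L) simp
      finally show "norm (blinfun_apply (act_star2 act \<Phi> f) b) \<le> \<bar>J\<bar> * L * norm f * norm b"
        by (simp add: ap f algebra_simps)
    qed
    then have "\<bar>K\<bar> * norm (act_star2 act \<Phi> f) \<le> \<bar>K\<bar> * (\<bar>J\<bar> * L * norm f)"
      by (intro mult_left_mono) auto
    moreover have "norm (\<Psi> (act_star2 act \<Phi> f)) \<le> \<bar>K\<bar> * norm (act_star2 act \<Phi> f)"
      using K[OF mem[OF f]] by (meson abs_ge_self mult_right_mono norm_ge_zero order_trans)
    ultimately show ?thesis by (simp add: algebra_simps)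
  qed
  then show ?thesis
    using \<Psi> unfolding bidual_def[of sB]
    by (auto simp: act_star3_def dadd dsc add2 sc2 mem)
qed

end

theory Submission
  imports Defs
begin

text \<open>
  Part (1) is Cohen's factorization theorem for the module \<open>B\<close> (\<open>factorization\<close>).

  For part (2), let \<open>f\<close> be in the dual of \<open>B\<close>, write \<open>a f\<close> for the dual action, and let \<open>N\<close> be the set of
  functionals \<open>g\<close> with \<open>x g \<rightarrow> g\<close> along a bounded approximate identity \<open>x\<close> of the algebra. Applied to the dual as a
  left module, Cohen's theorem factors the members of \<open>N\<close>, so it suffices to show that \<open>f\<close> lies in \<open>N\<close>.
  The set \<open>N\<close> is a closed subspace (\<open>closed_net_fixed\<close>) and contains every \<open>a f\<close>, since
  \<open>x (a f) = (x a) f \<rightarrow> a f\<close>.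

  The hypothesis on the centre yields, along a finer filter, \<open>e i f \<rightarrow> f\<close> weakly
  (\<open>weakly_tendsto_dual_lact\<close>): the net \<open>e\<close> has a weak-star cluster point in the bidual of the algebra which
  fixes \<open>f\<close>, and weak-star continuity of the extended action carries the convergence over.
  Thus \<open>f\<close> is a weak limit of elements of \<open>N\<close>. By the Hahn-Banach theorem (\<open>hahn_banach_separation\<close>,
  transferred to the scalar field \<open>'k\<close> in \<open>bidual_separation\<close>) closed subspaces are weakly closed, so \<open>f\<close> is in
  \<open>N\<close>.
\<close>

section \<open>Cohen's factorization theorem\<close>

text \<open>
  This plays the
  part of a bounded inverse of \<open>T\<close>, but survives composition and perturbation without any
  discussion of injectivity.
\<close>

definition solvable_on :: "'b::real_normed_vector set \<Rightarrow> ('b \<Rightarrow> 'b) \<Rightarrow> real \<Rightarrow> bool" where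
  "solvable_on S T C \<longleftrightarrow> (\<forall>z\<in>S. \<exists>y\<in>S. T y = z \<and> norm y \<le> C * norm z)"

lemma solvable_on_compose:
  assumes "solvable_on S T C" "solvable_on S U D" "C \<ge> 0"
  shows "solvable_on S (\<lambda>y. U (T y)) (C * D)"
  unfolding solvable_on_def
proof
  fix z assume "z \<in> S"
  then obtain w where w: "w \<in> S" "U w = z" "norm w \<le> D * norm z"
    using assms(2) unfolding solvable_on_def by blast
  then obtain y where y: "y \<in> S" "T y = w" "norm y \<le> C * norm w"
    using assms(1) unfolding solvable_on_def by blast
  have "norm y \<le> C * D * norm z"
    using y(3) mult_left_mono[OF w(3) assms(3)] by (simp add: mult.assoc)
  with y w show "\<exists>y\<in>S. U (T y) = z \<and> norm y \<le> C * D * norm z" by blast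
qed

text \<open>
  Neumann series without an inverse: solve \<open>T y = z\<close>, take the error \<open>- D y\<close> as the next right-hand
  side, and iterate. Errors at least halve, so the corrections sum to a solution.
\<close>

lemma solvable_on_perturb:
  fixes T D :: "'b::banach \<Rightarrow> 'b"
  assumes S: "closed S" "subspace S" and T: "bounded_linear T" and D: "bounded_linear D"
    and DS: "\<And>y. y \<in> S \<Longrightarrow> D y \<in> S"
    and sol: "solvable_on S T C" and C: "C \<ge> 0"
    and small: "\<And>y. C * norm (D y) \<le> norm y / 2"
  shows "solvable_on S (\<lambda>y. T y + D y) (2 * C)"
  unfolding solvable_on_def
proof
  interpret T: bounded_linear T by (rule T)
  interpret D: bounded_linear D by (rule D)
  fix z assume z: "z \<in> S"
  have "\<forall>z. \<exists>y. z \<in> S \<longrightarrow> y \<in> S \<and> T y = z \<and> norm y \<le> C * norm z"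
    using sol unfolding solvable_on_def by blast
  then obtain s where s: "\<And>z. z \<in> S \<Longrightarrow> s z \<in> S \<and> T (s z) = z \<and> norm (s z) \<le> C * norm z"
    by metis
  define r where "r n = ((\<lambda>w. - D (s w)) ^^ n) z" for n
  have rS: "r n \<in> S" for n
    by (induction n) (auto simp: r_def z intro!: subspace_neg[OF S(2)] DS s[THEN conjunct1])
  have rSuc: "r (Suc n) = - D (s (r n))" for n by (simp add: r_def)
  \<comment> \<open>The halving is measured on \<open>C * norm\<close>, so that the case \<open>C = 0\<close> needs no division.\<close>
  have rb: "C * norm (r n) \<le> C * norm z * (1/2) ^ n" for n
  proof (induction n)
    case (Suc n)
    have "C * norm (r (Suc n)) \<le> norm (s (r n)) / 2"
      using small[of "s (r n)"] by (simp add: rSuc)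
    also have "\<dots> \<le> C * norm (r n) / 2" using s[OF rS[of n]] by simp
    finally show ?case using Suc by simp
  qed (simp add: r_def)
  have yb: "norm (s (r n)) \<le> C * norm z * (1/2) ^ n" for n
    using s[OF rS[of n]] rb[of n] by linarith
  have gs: "(\<lambda>n. C * norm z * (1/2) ^ n) sums (2 * C * norm z)"
    using sums_mult[OF geometric_sums[of "1/2::real"], of "C * norm z"] by (simp add: mult_ac)
  have sumn: "summable (\<lambda>n. norm (s (r n)))"
    by (rule summable_comparison_test[OF _ sums_summable[OF gs]]) (use yb in auto)
  then have sm: "summable (\<lambda>n. s (r n))" by (rule summable_norm_cancel)
  define y where "y = (\<Sum>n. s (r n))"
  have "(\<Sum>k<n. s (r k)) \<in> S" for n
    by (intro subspace_sum[OF S(2)]) (use s[OF rS] in blast)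
  then have "y \<in> S"
    unfolding y_def by (rule closed_sequentially[OF S(1) _ summable_LIMSEQ[OF sm]])
  moreover have "norm y \<le> 2 * C * norm z"
  proof -
    have "norm y \<le> (\<Sum>n. norm (s (r n)))" unfolding y_def by (rule summable_norm[OF sumn])
    also have "\<dots> \<le> (\<Sum>n. C * norm z * (1/2) ^ n)"
      by (rule suminf_le[OF yb sumn sums_summable[OF gs]])
    finally show ?thesis using sums_unique[OF gs] by simp
  qed
  moreover have "T y + D y = z"
  proof -
    have "(\<lambda>n. D (s (r n))) sums D y"
      unfolding y_def by (rule D.sums[OF summable_sums[OF sm]])
    moreover have Ty: "(\<lambda>n. T (s (r n))) sums T y"
      unfolding y_def by (rule T.sums[OF summable_sums[OF sm]])
    ultimately have 1: "(\<lambda>n. r n - r (Suc n)) sums (T y + D y)"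
      using sums_add[of "\<lambda>n. T (s (r n))" "T y" "\<lambda>n. D (s (r n))" "D y"] s[OF rS] by (simp add: rSuc)
    have "r \<longlonglongrightarrow> 0"
      using summable_LIMSEQ_zero[OF sums_summable[OF Ty]] s[OF rS] by simp
    from telescope_sums'[OF this] have "(\<lambda>n. r n - r (Suc n)) sums z" by (simp add: r_def)
    with 1 show ?thesis by (rule sums_unique2)
  qed
  ultimately show "\<exists>y\<in>S. T y + D y = z \<and> norm y \<le> 2 * C * norm z" by blast
qed

text \<open>
  A Banach module over a Banach algebra, with a bounded net acting as a right approximate identity
  on the algebra and a closed invariant subspace \<open>S\<close>. The product of the algebra is a parameter
  \<open>m\<close> so that a left module becomes a right module over the opposite product \<open>\<lambda>a b. b * a\<close>.
\<close>

locale net_action =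
  fixes act :: "'b::banach \<Rightarrow> 'a::banach \<Rightarrow> 'b" and m :: "'a \<Rightarrow> 'a \<Rightarrow> 'a"
    and e :: "'i \<Rightarrow> 'a" and F :: "'i filter" and S :: "'b set"
  assumes act: "bounded_bilinear act"
    and act_act: "act (act y a) b = act y (m a b)"
    and F: "F \<noteq> bot"
    and bounded: "Bfun e F"
    and m_tendsto: "((\<lambda>i. m a (e i)) \<longlongrightarrow> a) F"
    and S: "closed S" "subspace S"
    and act_S: "y \<in> S \<Longrightarrow> act y a \<in> S"
begin

sublocale act: bounded_bilinear act by (rule act)

text \<open>
  Cohen's factorization theorem. The classical proof builds elements
  \<open>a\<^sub>n = (1 - c)\<^sup>n + b\<^sub>n\<close> of the unitization, with \<open>b\<^sub>n\<close> in the algebra, which are invertible and for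
  which both \<open>a\<^sub>n\<close> and the quotients \<open>x / a\<^sub>n\<close> converge; in the limit the multiple of the unit has
  disappeared and \<open>x\<close> is factored. Here \<open>a\<^sub>n\<close> is represented by the operator \<open>P\<close> by which
  it acts on the module, and \<open>x / a\<^sub>n\<close> by some solution \<open>y\<close> of \<open>P y = x\<close>, so that no
  unitization is formed. The next \<open>a\<^sub>n\<close> is \<open>a\<^sub>n ((1 - c) + c e)\<close> with \<open>c b\<^sub>n e\<close> replaced by \<open>c b\<^sub>n\<close>; this error is
  small when \<open>e\<close> is far out in the net.
\<close>

lemma factorization:
  assumes x: "x \<in> S" and x_tendsto: "((\<lambda>i. act x (e i)) \<longlongrightarrow> x) F"
  shows "\<exists>y\<in>S. \<exists>a. x = act y a"
proof -
  obtain M where M: "M > 0" "eventually (\<lambda>i. norm (e i) \<le> M) F"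
    using bounded unfolding Bfun_def by blast
  obtain K where K: "K > 0" "\<And>y a. norm (act y a) \<le> norm y * norm a * K"
    using act.pos_bounded by blast
  \<comment> \<open>With this \<open>c\<close>, multiplication by \<open>(1 - c) + c e\<close> differs from the identity by norm at most \<open>1/2\<close>.\<close>
  define c where "c = 1 / (2 * (1 + K * M))"
  have KM: "K * M > 0" using K M by simp
  have c: "0 < c" "c < 1" "c * (1 + K * M) = 1/2"
    using KM by (auto simp: c_def field_simps)
  define P where "P l b y = l *\<^sub>R y + act y b" for l :: real and b y
  have P_lin: "bounded_linear (P l b)" for l b
    unfolding P_def by (intro bounded_linear_add bounded_linear_scaleR_right act.bounded_linear_left)
  \<comment> \<open>The tolerance \<open>\<epsilon>\<close> may be chosen after \<open>b\<close>, \<open>y\<close> and \<open>C\<close>, so the growth of \<open>C\<close> along the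
      iteration is harmless.\<close>
  have step: "\<exists>b' y'. (y' \<in> S \<and> P ((1 - c) * l) b' y' = x \<and> (\<exists>C\<ge>0. solvable_on S (P ((1 - c) * l) b') C))
      \<and> norm (b' - b) \<le> c * M * l \<and> norm (y' - y) \<le> \<epsilon>"
    if y: "y \<in> S" "P l b y = x" and sol: "C \<ge> 0" "solvable_on S (P l b) C"
      and l: "l > 0" and \<epsilon>: "\<epsilon> > 0" for l b y C \<epsilon>
  proof -
    define C' where "C' = 2 * (C * 2)"
    \<comment> \<open>The first bound lets \<open>act w \<delta>\<close> count as a perturbation; the second keeps the new
        solution within \<open>\<epsilon>\<close> of \<open>y\<close>.\<close>
    define \<eta> where "\<eta> = min (1 / (4 * (C + 1) * K)) (\<epsilon> / (2 * (C' + 1) * (norm y * K + 1)))"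
    have C': "C' \<ge> 0" using sol by (simp add: C'_def)
    have \<eta>: "\<eta> > 0" using C' sol K \<epsilon> by (simp add: \<eta>_def add_nonneg_pos)
    have "eventually (\<lambda>i. norm (e i) \<le> M \<and> dist (m b (e i)) b < \<eta> \<and> dist (act x (e i)) x < \<eta>) F"
      using M(2) tendstoD[OF m_tendsto \<eta>] tendstoD[OF x_tendsto \<eta>] by eventually_elim auto
    then obtain i where i: "norm (e i) \<le> M" "norm (b - m b (e i)) < \<eta>" "norm (x - act x (e i)) < \<eta>"
      using F eventually_happens'[OF F] by (metis (no_types, lifting) dist_norm norm_minus_commute)
    define U where "U w = w + c *\<^sub>R (act w (e i) - w)" for w
    define \<delta> where "\<delta> = c *\<^sub>R (b - m b (e i))"
    define b' where "b' = b + (c * l) *\<^sub>R e i"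
    have \<delta>: "norm \<delta> \<le> \<eta>" using i(2) c mult_right_mono[of c 1 "norm (b - m b (e i))"] by (simp add: \<delta>_def)
    have decomp: "P ((1 - c) * l) b' w = U (P l b w) + act w \<delta>" for w
      unfolding P_def U_def \<delta>_def b'_def
      by (simp add: act.add_left act.add_right act.scaleR_left act.scaleR_right act.diff_right
          act_act algebra_simps)
    have "solvable_on S U 2"
    proof -
      have "solvable_on S (\<lambda>w. w + c *\<^sub>R (act w (e i) - w)) (2 * 1)"
      proof (rule solvable_on_perturb[OF S bounded_linear_ident])
        show "bounded_linear (\<lambda>w. c *\<^sub>R (act w (e i) - w))"
          by (intro bounded_linear_compose[OF bounded_linear_scaleR_right] bounded_linear_sub
              act.bounded_linear_left bounded_linear_ident)
        show "c *\<^sub>R (act w (e i) - w) \<in> S" if "w \<in> S" for w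
          by (intro subspace_scale[OF S(2)] subspace_diff[OF S(2)] act_S that)
        show "solvable_on S (\<lambda>w. w) 1" by (auto simp: solvable_on_def)
        show "1 * norm (c *\<^sub>R (act w (e i) - w)) \<le> norm w / 2" for w
        proof -
          have "norm (act w (e i)) \<le> norm w * M * K"
            using K(2)[of w "e i"] i(1) K(1)
            by (smt (verit) mult_left_mono mult_right_mono norm_ge_zero)
          then have "norm (act w (e i) - w) \<le> (1 + K * M) * norm w"
            using norm_triangle_ineq4[of "act w (e i)" w] by (simp add: algebra_simps)
          then have "c * norm (act w (e i) - w) \<le> c * ((1 + K * M) * norm w)"
            using c by (intro mult_left_mono) auto
          also have "\<dots> = norm w / 2" by (subst mult.assoc[symmetric], subst c(3)) simp
          finally show ?thesis using c by simp
        qed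
      qed simp
      then show ?thesis by (simp add: U_def[abs_def])
    qed
    then have UP: "solvable_on S (\<lambda>w. U (P l b w)) (C * 2)"
      by (rule solvable_on_compose[OF sol(2) _ sol(1)])
    have sol': "solvable_on S (P ((1 - c) * l) b') C'"
    proof -
      have "solvable_on S (\<lambda>w. U (P l b w) + act w \<delta>) (2 * (C * 2))"
      proof (rule solvable_on_perturb[OF S _ act.bounded_linear_left _ UP])
        show "bounded_linear (\<lambda>w. U (P l b w))"
          unfolding U_def
          by (intro bounded_linear_add P_lin bounded_linear_compose[OF bounded_linear_scaleR_right]
              bounded_linear_sub bounded_linear_compose[OF act.bounded_linear_left])
        show "C * 2 * norm (act w \<delta>) \<le> norm w / 2" for w
        proof -
          have "norm \<delta> \<le> 1 / (4 * (C + 1) * K)" using \<delta> by (simp add: \<eta>_def)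
          moreover have "4 * (C + 1) * K > 0" using sol K by simp
          ultimately have "4 * (C + 1) * K * norm \<delta> \<le> 1"
            by (simp only: pos_le_divide_eq mult.commute[of "norm \<delta>"])
          then have h: "4 * (C * (K * norm \<delta>)) \<le> 1"
            using K by (simp add: algebra_simps) (smt (verit) norm_ge_zero mult_nonneg_nonneg)
          have "C * 2 * norm (act w \<delta>) \<le> C * 2 * (norm w * norm \<delta> * K)"
            using sol by (intro mult_left_mono K) auto
          also have "\<dots> = (4 * (C * (K * norm \<delta>))) * norm w / 2" by simp
          also have "\<dots> \<le> 1 * norm w / 2"
            by (intro divide_right_mono mult_right_mono h) auto
          finally show ?thesis by simp
        qed
      qed (use sol act_S in auto)
      then show ?thesis by (simp add: decomp[abs_def] C'_def)
    qed
    \<comment> \<open>Solutions need not be unique: the new one must be obtained by correcting \<open>y\<close>, as an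
        arbitrary solution could be far from \<open>y\<close>.\<close>
    define z where "z = x - P ((1 - c) * l) b' y"
    have z_eq: "z = c *\<^sub>R (x - act x (e i)) - act y \<delta>"
      unfolding z_def decomp y(2) U_def by (simp add: algebra_simps)
    have "z \<in> S"
      unfolding z_eq by (intro subspace_scale[OF S(2)] subspace_diff[OF S(2)] act_S x y(1))
    then obtain w where w: "w \<in> S" "P ((1 - c) * l) b' w = z" "norm w \<le> C' * norm z"
      using sol' unfolding solvable_on_def by blast
    have "norm z \<le> \<eta> * (norm y * K + 1)"
    proof -
      have "norm (act y \<delta>) \<le> norm y * \<eta> * K"
        using K(2)[of y \<delta>] \<delta> K(1) by (smt (verit) mult_left_mono mult_right_mono norm_ge_zero)
      moreover have "norm (c *\<^sub>R (x - act x (e i))) \<le> \<eta>"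
        using i(3) c mult_right_mono[of c 1 "norm (x - act x (e i))"] by simp
      ultimately show ?thesis
        unfolding z_eq using norm_triangle_ineq4[of "c *\<^sub>R (x - act x (e i))" "act y \<delta>"]
        by (simp add: algebra_simps)
    qed
    moreover have "\<eta> * (norm y * K + 1) \<le> \<epsilon> / (2 * (C' + 1))"
    proof -
      have "norm y * K + 1 > 0" using K by (simp add: add_nonneg_pos)
      moreover have "\<eta> \<le> \<epsilon> / (2 * (C' + 1) * (norm y * K + 1))" by (simp add: \<eta>_def)
      ultimately have "\<eta> * (norm y * K + 1) \<le> \<epsilon> / (2 * (C' + 1) * (norm y * K + 1)) * (norm y * K + 1)"
        by (intro mult_right_mono) auto
      with \<open>norm y * K + 1 > 0\<close> show ?thesis by simp
    qed
    ultimately have "norm w \<le> C' * (\<epsilon> / (2 * (C' + 1)))"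
      using w(3) mult_left_mono[OF _ C', of "norm z" "\<epsilon> / (2 * (C' + 1))"] by linarith
    also have "\<dots> \<le> \<epsilon>"
      using C' \<epsilon> by (simp add: field_simps add_nonneg_pos)
    finally have "norm (y + w - y) \<le> \<epsilon>" by simp
    moreover have "P ((1 - c) * l) b' (y + w) = x"
      using linear_add[OF bounded_linear.linear[OF P_lin], of "(1 - c) * l" b' y w] w(2) by (simp add: z_def)
    moreover have "norm (b' - b) \<le> c * M * l"
      using c l mult_left_mono[OF i(1), of "c * l"] by (simp add: b'_def mult_ac)
    moreover have "y + w \<in> S" by (rule subspace_add[OF S(2) y(1) w(1)])
    ultimately show ?thesis using sol' C' by blast
  qed
  define Q where "Q n s \<longleftrightarrow> snd s \<in> S \<and> P ((1 - c) ^ n) (fst s) (snd s) = x \<and>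
      (\<exists>C\<ge>0. solvable_on S (P ((1 - c) ^ n) (fst s)) C)" for n :: nat and s :: "'a \<times> 'b"
  have Q_step: "\<exists>s'. Q (Suc n) s' \<and>
      (norm (fst s' - fst s) \<le> c * M * (1 - c) ^ n \<and> norm (snd s' - snd s) \<le> (1/2) ^ n)"
    if Q: "Q n s" for n s
  proof -
    obtain C where "C \<ge> 0" "solvable_on S (P ((1 - c) ^ n) (fst s)) C"
      using Q unfolding Q_def by blast
    with Q c step[of "snd s" "(1 - c) ^ n" "fst s" C "(1/2) ^ n"] show ?thesis
      unfolding Q_def by simp
  qed
  have "\<exists>s. Q 0 s"
    unfolding Q_def P_def using x
    by (intro exI[of _ "(0, x)"]) (auto simp: solvable_on_def act.zero_right intro!: exI[of _ 1])
  then obtain s where Qs: "\<And>n. Q n (s n)"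
    and s: "\<And>n. norm (fst (s (Suc n)) - fst (s n)) \<le> c * M * (1 - c) ^ n"
      "\<And>n. norm (snd (s (Suc n)) - snd (s n)) \<le> (1/2) ^ n"
    using dependent_nat_choice[of Q "\<lambda>n s s'. norm (fst s' - fst s) \<le> c * M * (1 - c) ^ n \<and>
      norm (snd s' - snd s) \<le> (1/2) ^ n"] Q_step by blast
  have conv: "convergent f"
    if "\<And>n. norm (f (Suc n) - f n) \<le> B * q ^ n" "0 \<le> q" "q < 1"
    for f :: "nat \<Rightarrow> 'v::banach" and B q :: real
  proof -
    have "summable (\<lambda>n. f (Suc n) - f n)"
      by (rule summable_comparison_test[of _ "\<lambda>n. B * q ^ n"])
        (use that in \<open>auto intro!: summable_mult summable_geometric\<close>)
    then have "convergent (\<lambda>n. \<Sum>k<n. f (Suc k) - f k)" by (simp add: summable_iff_convergent)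
    then show ?thesis by (simp add: sum_lessThan_telescope convergent_diff_const_right_iff)
  qed
  obtain a where a: "(\<lambda>n. fst (s n)) \<longlonglongrightarrow> a"
    using conv[of "\<lambda>n. fst (s n)" "c * M" "1 - c"] s(1) c by (auto simp: convergent_def)
  obtain y where y: "(\<lambda>n. snd (s n)) \<longlonglongrightarrow> y"
    using conv[of "\<lambda>n. snd (s n)" 1 "1/2"] s(2) by (auto simp: convergent_def)
  have "(\<lambda>n. (1 - c) ^ n) \<longlonglongrightarrow> 0" using c by (intro LIMSEQ_realpow_zero) auto
  then have "(\<lambda>n. P ((1 - c) ^ n) (fst (s n)) (snd (s n))) \<longlonglongrightarrow> 0 *\<^sub>R y + act y a"
    unfolding P_def by (intro tendsto_add tendsto_scaleR act.tendsto a y)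
  then have "(\<lambda>n::nat. x) \<longlonglongrightarrow> act y a" using Qs by (simp add: Q_def)
  then have "x = act y a" by (simp add: LIMSEQ_const_iff)
  moreover have "y \<in> S"
    using closed_sequentially[OF S(1) _ y] Qs by (simp add: Q_def)
  ultimately show ?thesis by blast
qed

end

section \<open>The Hahn-Banach theorem\<close>

definition sublinear :: "('v::real_vector \<Rightarrow> real) \<Rightarrow> bool" where
  "sublinear p \<longleftrightarrow> (\<forall>x y. p (x + y) \<le> p x + p y) \<and> (\<forall>t x. t \<ge> 0 \<longrightarrow> p (t *\<^sub>R x) = t * p x)"

lemma sublinearI:
  assumes "\<And>x y. p (x + y) \<le> p x + p y" and "p 0 = 0"
    and le: "\<And>t x. t > 0 \<Longrightarrow> p (t *\<^sub>R x) \<le> t * p x"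
  shows "sublinear p"
  unfolding sublinear_def
proof (intro conjI allI impI)
  fix t :: real and x assume "t \<ge> 0"
  show "p (t *\<^sub>R x) = t * p x"
  proof (cases "t = 0")
    case False
    with \<open>t \<ge> 0\<close> have t: "t > 0" by simp
    have "p x \<le> inverse t * p (t *\<^sub>R x)" using le[of "inverse t" "t *\<^sub>R x"] t by simp
    then have "t * p x \<le> p (t *\<^sub>R x)" using t by (simp add: field_simps)
    with le[OF t, of x] show ?thesis by simp
  qed (simp add: assms(2))
qed (rule assms(1))

lemma sublinear_zero: "sublinear p \<Longrightarrow> p 0 = 0"
  unfolding sublinear_def by (metis mult_zero_left order_refl scaleR_zero_left)

lemma sublinear_minus_le: "sublinear p \<Longrightarrow> - p (- x) \<le> p x"
proof -
  assume p: "sublinear p"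
  then have "p (x + - x) \<le> p x + p (- x)" unfolding sublinear_def by blast
  then show ?thesis using sublinear_zero[OF p] by simp
qed

lemma le_INF_add_INF:
  fixes f g :: "'i \<Rightarrow> real"
  assumes "I \<noteq> {}" "\<And>i j. i \<in> I \<Longrightarrow> j \<in> I \<Longrightarrow> r \<le> f i + g j"
  shows "r \<le> (INF i\<in>I. f i) + (INF j\<in>I. g j)"
proof -
  have "r - f i \<le> (INF j\<in>I. g j)" if "i \<in> I" for i
    using assms(2)[OF that] by (intro cINF_greatest assms(1)) (simp add: algebra_simps)
  then have "r - (INF j\<in>I. g j) \<le> (INF i\<in>I. f i)"
    by (intro cINF_greatest assms(1)) (simp add: algebra_simps)
  then show ?thesis by simp
qed

lemma le_mult_INF:
  fixes f :: "'i \<Rightarrow> real"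
  assumes "I \<noteq> {}" "t > 0" "\<And>i. i \<in> I \<Longrightarrow> r \<le> t * f i"
  shows "r \<le> t * (INF i\<in>I. f i)"
proof -
  have "r / t \<le> (INF i\<in>I. f i)"
    using assms by (intro cINF_greatest) (auto simp: field_simps)
  then show ?thesis using assms(2) by (simp add: field_simps)
qed

text \<open>
  The sublinear functional obtained from \<open>p\<close> by making it as small as possible at \<open>- z\<close>, where it
  becomes \<open>- p z\<close>. A functional that admits no smaller sublinear one is therefore odd, hence linear.
\<close>

definition tilt :: "('v::real_vector \<Rightarrow> real) \<Rightarrow> 'v \<Rightarrow> 'v \<Rightarrow> real" where
  "tilt p z x = (INF t\<in>{0..}. p (x + t *\<^sub>R z) - t * p z)"

context
  fixes p :: "'v::real_vector \<Rightarrow> real" assumes p: "sublinear p"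
begin

lemma tilt_le:
  assumes "t \<ge> 0"
  shows "tilt p z x \<le> p (x + t *\<^sub>R z) - t * p z"
  unfolding tilt_def
proof (rule cINF_lower)
  have "- p (- x) \<le> p (x + t *\<^sub>R z) - t * p z" if "t \<ge> 0" for t
  proof -
    have "p (x + t *\<^sub>R z + - x) \<le> p (x + t *\<^sub>R z) + p (- x)" "p (t *\<^sub>R z) = t * p z"
      using p that unfolding sublinear_def by blast+
    then show ?thesis by simp
  qed
  then show "bdd_below ((\<lambda>t. p (x + t *\<^sub>R z) - t * p z) ` {0..})"
    by (intro bdd_belowI2) auto
qed (use assms in auto)

lemma sublinear_tilt: "sublinear (tilt p z)"
proof (rule sublinearI)
  fix x y
  show "tilt p z (x + y) \<le> tilt p z x + tilt p z y"
    unfolding tilt_def[of p z x] tilt_def[of p z y]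
  proof (rule le_INF_add_INF)
    fix s t :: real assume "s \<in> {0..}" "t \<in> {0..}"
    then have "tilt p z (x + y) \<le> p (x + y + (s + t) *\<^sub>R z) - (s + t) * p z"
      by (intro tilt_le) auto
    moreover have "p (x + y + (s + t) *\<^sub>R z) \<le> p (x + s *\<^sub>R z) + p (y + t *\<^sub>R z)"
    proof -
      have "x + y + (s + t) *\<^sub>R z = (x + s *\<^sub>R z) + (y + t *\<^sub>R z)" by (simp add: algebra_simps)
      then show ?thesis using p unfolding sublinear_def by metis
    qed
    ultimately show "tilt p z (x + y) \<le> p (x + s *\<^sub>R z) - s * p z + (p (y + t *\<^sub>R z) - t * p z)"
      by (simp add: algebra_simps)
  qed auto
next
  have "p (0 + t *\<^sub>R z) - t * p z = 0" if "t \<in> {0..}" for t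
    using p that by (simp add: sublinear_def)
  then have "tilt p z 0 = (INF t\<in>{0::real..}. 0)"
    unfolding tilt_def by (intro INF_cong) auto
  then show "tilt p z 0 = 0" by simp
next
  fix c :: real and x assume c: "c > 0"
  show "tilt p z (c *\<^sub>R x) \<le> c * tilt p z x"
    unfolding tilt_def[of p z x]
  proof (rule le_mult_INF[OF _ c])
    fix t :: real assume "t \<in> {0..}"
    then have "tilt p z (c *\<^sub>R x) \<le> p (c *\<^sub>R x + (c * t) *\<^sub>R z) - (c * t) * p z"
      using c by (intro tilt_le) auto
    also have "p (c *\<^sub>R x + (c * t) *\<^sub>R z) = c * p (x + t *\<^sub>R z)"
    proof -
      have "c *\<^sub>R x + (c * t) *\<^sub>R z = c *\<^sub>R (x + t *\<^sub>R z)" by (simp add: algebra_simps)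
      then show ?thesis using p c unfolding sublinear_def by simp
    qed
    finally show "tilt p z (c *\<^sub>R x) \<le> c * (p (x + t *\<^sub>R z) - t * p z)"
      by (simp add: algebra_simps)
  qed auto
qed

lemma tilt_le_self: "tilt p z x \<le> p x"
  using tilt_le[of 0 z x] by simp

lemma tilt_minus_le: "tilt p z (- z) \<le> - p z"
  using tilt_le[of 1 z "- z"] sublinear_zero[OF p] by simp

end

lemma sublinear_odd_imp_linear:
  assumes p: "sublinear p" and odd: "\<And>x. p (- x) = - p x"
  shows "linear p"
proof (rule linearI)
  fix x y
  have "p (- x + - y) \<le> p (- x) + p (- y)" using p unfolding sublinear_def by blast
  moreover have "p (x + y) \<le> p x + p y" using p unfolding sublinear_def by blast
  moreover have "p (- x + - y) = - p (x + y)" using odd[of "x + y"] by simp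
  ultimately show "p (x + y) = p x + p y" by (simp add: odd)
next
  fix t x
  show "p (t *\<^sub>R x) = t *\<^sub>R p x"
  proof (cases "t \<ge> 0")
    case False
    then have "- t \<ge> 0" by simp
    then have "p ((- t) *\<^sub>R x) = - t * p x" using p unfolding sublinear_def by blast
    moreover have "(- t) *\<^sub>R x = - (t *\<^sub>R x)" by simp
    ultimately show ?thesis using odd[of "t *\<^sub>R x"] by simp
  qed (use p in \<open>simp add: sublinear_def\<close>)
qed

text \<open>
  Zorn's lemma downwards. The pointwise infimum of a chain is finite because every sublinear
  \<open>q \<le> p\<close> satisfies \<open>q x \<ge> - p (- x)\<close>, and subadditive because any two members of the chain have a
  smaller one below both.
\<close>

lemma minimal_sublinear:
  fixes p :: "'v::real_vector \<Rightarrow> real"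
  assumes p: "sublinear p"
  shows "\<exists>q. sublinear q \<and> q \<le> p \<and> (\<forall>q'. sublinear q' \<longrightarrow> q' \<le> q \<longrightarrow> q' = q)"
proof -
  define A where "A = {q. sublinear q \<and> q \<le> p}"
  have "\<exists>q\<in>A. \<forall>q'\<in>A. q \<ge> q' \<longrightarrow> q' = q"
  proof (rule predicate_Zorn)
    show "partial_order_on A (relation_of (\<ge>) A)"
      by (rule partial_order_on_relation_ofI) auto
    fix C assume "C \<in> Chains (relation_of (\<ge>) A)"
    then have C: "C \<subseteq> A" "\<And>q r. q \<in> C \<Longrightarrow> r \<in> C \<Longrightarrow> q \<le> r \<or> r \<le> q"
      unfolding Chains_def relation_of_def by auto
    show "\<exists>u\<in>A. \<forall>q\<in>C. u \<le> q"
    proof (cases "C = {}")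
      case True
      then show ?thesis using p by (auto simp: A_def)
    next
      case False
      define u where "u x = (INF q\<in>C. q x)" for x
      have sub: "sublinear q" "q x \<le> p x" if "q \<in> C" for q x
        using that C(1) by (auto simp: A_def le_fun_def)
      have lower: "u x \<le> q x" if "q \<in> C" for q x
        unfolding u_def
      proof (rule cINF_lower[OF _ that], rule bdd_belowI2)
        fix r assume "r \<in> C"
        then show "- p (- x) \<le> r x"
          using sublinear_minus_le[OF sub(1), of r x] sub(2)[of r "- x"] by linarith
      qed
      have "sublinear u"
      proof (rule sublinearI)
        fix x y
        show "u (x + y) \<le> u x + u y"
          unfolding u_def[of x] u_def[of y]
        proof (rule le_INF_add_INF[OF False])
          fix q r assume qr: "q \<in> C" "r \<in> C"
          then obtain s where s: "s \<in> C" "s \<le> q" "s \<le> r" using C(2)[OF qr] by blast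
          have "s (x + y) \<le> s x + s y" using sub(1)[OF s(1)] unfolding sublinear_def by blast
          then show "u (x + y) \<le> q x + r y"
            using lower[OF s(1), of "x + y"] le_funD[OF s(2), of x] le_funD[OF s(3), of y] by linarith
        qed
      next
        have "u 0 = (INF q\<in>C. 0)"
          unfolding u_def by (intro INF_cong refl) (simp add: sublinear_zero sub(1))
        then show "u 0 = 0" using False by simp
      next
        fix t :: real and x assume t: "t > 0"
        show "u (t *\<^sub>R x) \<le> t * u x"
          unfolding u_def[of x]
        proof (rule le_mult_INF[OF False t])
          fix q assume q: "q \<in> C"
          then show "u (t *\<^sub>R x) \<le> t * q x"
            using lower[OF q, of "t *\<^sub>R x"] sub(1)[OF q] t by (simp add: sublinear_def)
        qed
      qed
      moreover have "u \<le> p"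
        using False lower sub(2) by (metis ex_in_conv le_funI order_trans)
      ultimately show ?thesis using lower by (auto simp: A_def le_fun_def)
    qed
  qed
  then show ?thesis unfolding A_def by (metis (mono_tags, lifting) mem_Collect_eq order_trans)
qed

text \<open>
  Any minimal sublinear functional below \<open>p\<close> is linear; starting the descent from \<open>tilt p x0\<close>
  instead of \<open>p\<close> forces the value at \<open>x0\<close>. Extending a functional from a subspace, and hence partial
  functions, are thereby avoided.
\<close>

lemma hahn_banach_sublinear:
  fixes p :: "'v::real_vector \<Rightarrow> real"
  assumes p: "sublinear p"
  shows "\<exists>u. linear u \<and> (\<forall>x. u x \<le> p x) \<and> u x0 = p x0"
proof -
  obtain q where q: "sublinear q" "q \<le> tilt p x0"
    and min: "\<And>q'. sublinear q' \<Longrightarrow> q' \<le> q \<Longrightarrow> q' = q"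
    using minimal_sublinear[OF sublinear_tilt[OF p]] by blast
  have "q (- z) = - q z" for z
  proof -
    have "tilt q z = q"
      by (intro min sublinear_tilt q le_funI tilt_le_self)
    then have "q (- z) \<le> - q z" using tilt_minus_le[OF q(1), of z] by simp
    with sublinear_minus_le[OF q(1), of z] show ?thesis by simp
  qed
  then have lin: "linear q" and odd: "q (- x0) = - q x0"
    by (auto intro: sublinear_odd_imp_linear q(1))
  have qp: "q x \<le> p x" for x
    using le_funD[OF q(2), of x] tilt_le_self[OF p, of x0 x] by linarith
  have "q (- x0) \<le> - p x0"
    using le_funD[OF q(2), of "- x0"] tilt_minus_le[OF p, of x0] by linarith
  with odd qp[of x0] have "q x0 = p x0" by simp
  with lin qp show ?thesis by blast
qed

lemma sublinear_infdist:
  fixes N :: "'v::real_normed_vector set"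
  assumes N: "subspace N"
  shows "sublinear (\<lambda>x. infdist x N)"
proof -
  have ne: "N \<noteq> {}" using subspace_0[OF N] by blast
  show ?thesis
  proof (rule sublinearI)
    fix x y
    show "infdist (x + y) N \<le> infdist x N + infdist y N"
      unfolding infdist_notempty[OF ne, of x] infdist_notempty[OF ne, of y]
    proof (rule le_INF_add_INF[OF ne])
      fix a b assume "a \<in> N" "b \<in> N"
      then have "infdist (x + y) N \<le> dist (x + y) (a + b)"
        by (intro infdist_le subspace_add[OF N])
      then show "infdist (x + y) N \<le> dist x a + dist y b"
        using dist_triangle_add[of x y a b] by linarith
    qed
  next
    fix t :: real and x assume t: "t > 0"
    show "infdist (t *\<^sub>R x) N \<le> t * infdist x N"
      unfolding infdist_notempty[OF ne, of x]
    proof (rule le_mult_INF[OF ne t])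
      fix a assume "a \<in> N"
      then have "infdist (t *\<^sub>R x) N \<le> dist (t *\<^sub>R x) (t *\<^sub>R a)"
        by (intro infdist_le subspace_scale[OF N])
      then show "infdist (t *\<^sub>R x) N \<le> t * dist x a"
        using t by (simp add: dist_norm flip: scaleR_diff_right)
    qed
  qed (simp add: subspace_0[OF N])
qed

lemma hahn_banach_separation:
  fixes N :: "'v::real_normed_vector set"
  assumes N: "subspace N" "closed N" and x0: "x0 \<notin> N"
  shows "\<exists>u. bounded_linear u \<and> (\<forall>x\<in>N. u x = 0) \<and> u x0 \<noteq> (0::real)"
proof -
  obtain u where u: "linear u" "\<And>x. u x \<le> infdist x N" "u x0 = infdist x0 N"
    using hahn_banach_sublinear[OF sublinear_infdist[OF N(1)]] by blast
  have neg: "u (- x) = - u x" for x by (rule linear_neg[OF u(1)])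
  have "u x \<le> norm x" for x
    using u(2)[of x] infdist_le[OF subspace_0[OF N(1)], of x] by simp
  from this this[of "- x" for x] have "\<bar>u x\<bar> \<le> norm x" for x
    by (metis abs_le_iff neg norm_minus_cancel)
  then have "bounded_linear u"
    using linear_add[OF u(1)] linear_cmul[OF u(1)] by (intro bounded_linear_intro[where K=1]) auto
  moreover have "u x = 0" if "x \<in> N" for x
    using u(2)[of x] u(2)[of "- x"] that subspace_neg[OF N(1) that] by (simp add: neg)
  moreover have "u x0 > 0"
    using infdist_pos_not_in_closed[OF N(2) _ x0] subspace_0[OF N(1)] u(3) by auto
  ultimately show ?thesis by force
qed

section \<open>Functionals on the dual\<close>

text \<open>
  Passage from \<open>real\<close> to \<open>'k\<close> scalars, replacing the formula \<open>u v - \<i> u (\<i> v)\<close> of the complex case.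
  Since \<open>'k\<close> is a field and \<open>1 \<bullet> 1 \<noteq> 0\<close>, the bilinear form \<open>(c, z) \<mapsto> (c * z) \<bullet> 1\<close> is nondegenerate, so
  the real functional \<open>c \<mapsto> u (sm c v)\<close> on \<open>'k\<close> equals \<open>c \<mapsto> (c * z) \<bullet> 1\<close> for a unique \<open>z\<close>; this \<open>z\<close> is
  the value at \<open>v\<close>, and its uniqueness gives \<open>'k\<close>-linearity.
\<close>

lemma real_linear_functional_lift:
  fixes sm :: "'k::{real_normed_field,euclidean_space} \<Rightarrow> 'v::real_normed_vector \<Rightarrow> 'v" and u :: "'v \<Rightarrow> real"
  assumes u: "bounded_linear u"
    and sm: "bounded_bilinear sm" "\<And>c d v. sm c (sm d v) = sm (c * d) v"
  shows "\<exists>\<Psi> :: 'v \<Rightarrow> 'k. bounded_linear \<Psi> \<and> (\<forall>c v. \<Psi> (sm c v) = c * \<Psi> v) \<and>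
    (\<forall>c v. (c * \<Psi> v) \<bullet> 1 = u (sm c v))"
proof -
  interpret u: bounded_linear u by (rule u)
  interpret sm: bounded_bilinear sm by (rule sm(1))
  define T where "T z = (\<Sum>b\<in>Basis. ((b * z) \<bullet> 1) *\<^sub>R b)" for z :: 'k
  have repr: "l c = c \<bullet> (\<Sum>b\<in>Basis. l b *\<^sub>R b)" if "linear l" for l :: "'k \<Rightarrow> real" and c
  proof -
    have "l c = l (\<Sum>b\<in>Basis. (c \<bullet> b) *\<^sub>R b)" by (simp add: euclidean_representation)
    also have "\<dots> = (\<Sum>b\<in>Basis. (c \<bullet> b) * l b)"
      by (simp add: linear_sum[OF that] linear_cmul[OF that])
    finally show ?thesis by (simp add: inner_sum_right mult.commute)
  qed
  have T: "(c * z) \<bullet> 1 = c \<bullet> T z" for c z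
    unfolding T_def
    by (rule repr) (auto intro!: linearI simp: distrib_right inner_add_left)
  have linT: "linear T"
    unfolding T_def
    by (intro linearI) (simp_all add: distrib_left inner_add_left scaleR_add_left sum.distrib scaleR_sum_right)
  have injT: "inj T"
    unfolding linear_injective_0[OF linT]
  proof (intro allI impI)
    fix z assume "T z = 0"
    then have "(inverse z * z) \<bullet> 1 = 0" using T[of "inverse z" z] by simp
    then show "z = 0" by (cases "z = 0") auto
  qed
  obtain R where R: "linear R" "\<And>v. T (R v) = v"
    using linear_surjective_right_inverse[OF linT linear_injective_imp_surjective[OF linT injT]]
    by (metis comp_apply id_apply)
  define \<Psi> where "\<Psi> v = R (\<Sum>b\<in>Basis. u (sm b v) *\<^sub>R b)" for v
  have rep: "(c * \<Psi> v) \<bullet> 1 = u (sm c v)" for c v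
    unfolding T \<Psi>_def R(2)
    by (rule repr[symmetric]) (auto intro!: linearI simp: sm.add_left sm.scaleR_left u.add u.scaleR)
  have hom: "\<Psi> (sm d v) = d * \<Psi> v" for d v
  proof -
    have "c \<bullet> T (\<Psi> (sm d v)) = c \<bullet> T (d * \<Psi> v)" for c
      using rep[of c "sm d v"] rep[of "c * d" v] by (simp add: T[symmetric] sm(2) mult.assoc)
    then have "T (\<Psi> (sm d v)) = T (d * \<Psi> v)" by (metis vector_eq_rdot inner_commute)
    then show ?thesis using injT by (simp add: inj_eq)
  qed
  have "bounded_linear \<Psi>"
    unfolding \<Psi>_def
    by (intro bounded_linear_compose[OF linear_conv_bounded_linear[THEN iffD1, OF R(1)]]
        bounded_linear_sum bounded_linear_compose[OF bounded_linear_scaleR_left]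
        bounded_linear_compose[OF u] sm.bounded_linear_right)
  with rep hom show ?thesis by blast
qed

lemma restrict_dual_mem_bidual:
  assumes add: "\<And>g h. \<Psi> (g + h) = \<Psi> g + \<Psi> h"
    and mult: "\<And>c g. \<Psi> (blinfun_mult_right c o\<^sub>L g) = c * \<Psi> g"
    and bound: "\<And>g. norm (\<Psi> g) \<le> K * norm g"
  shows "restrict \<Psi> (dual s) \<in> bidual s"
proof -
  have "g + h \<in> dual s" if "g \<in> dual s" "h \<in> dual s" for g h
    using that by (simp add: dual_def blinfun.add_left algebra_simps)
  moreover have "blinfun_mult_right c o\<^sub>L g \<in> dual s" if "g \<in> dual s" for c g
    using that by (simp add: dual_def)
  ultimately show ?thesis
    by (auto simp: bidual_def add mult intro!: exI[of _ K] bound)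
qed

lemma bidual_separation:
  fixes sB :: "'k::{real_normed_field,euclidean_space} \<Rightarrow> 'b::real_normed_vector \<Rightarrow> 'b"
  assumes N: "closed N" "subspace N" and scale: "\<And>c g. g \<in> N \<Longrightarrow> blinfun_mult_right c o\<^sub>L g \<in> N"
    and f: "f \<in> dual sB" "f \<notin> N"
  shows "\<exists>\<Psi>\<in>bidual sB. (\<forall>g\<in>N \<inter> dual sB. \<Psi> g = 0) \<and> \<Psi> f \<noteq> 0"
proof -
  obtain u :: "('b \<Rightarrow>\<^sub>L 'k) \<Rightarrow> real" where u: "bounded_linear u" "\<And>g. g \<in> N \<Longrightarrow> u g = 0" "u f \<noteq> 0"
    using hahn_banach_separation[OF N(2,1) f(2)] by blast
  define sm where "sm c g = blinfun_mult_right c o\<^sub>L g" for c :: 'k and g :: "'b \<Rightarrow>\<^sub>L 'k"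
  have "bounded_bilinear sm"
    unfolding sm_def
    by (rule bounded_bilinear.comp1[OF bounded_bilinear_blinfun_compose bounded_linear_blinfun_mult_right])
  moreover have "sm c (sm d g) = sm (c * d) g" for c d g
    unfolding sm_def by (rule blinfun_eqI) simp
  ultimately obtain \<Psi> :: "('b \<Rightarrow>\<^sub>L 'k) \<Rightarrow> 'k" where \<Psi>: "bounded_linear \<Psi>"
      "\<And>c g. \<Psi> (sm c g) = c * \<Psi> g" "\<And>c g. (c * \<Psi> g) \<bullet> 1 = u (sm c g)"
    using real_linear_functional_lift[OF u(1), of sm] by metis
  have "\<Psi> g = 0" if "g \<in> N" for g
  proof (rule ccontr)
    assume "\<Psi> g \<noteq> 0"
    then have "(1 :: 'k) \<bullet> 1 = u (sm (inverse (\<Psi> g)) g)"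
      using \<Psi>(3)[of "inverse (\<Psi> g)" g] by simp
    also have "\<dots> = 0" using scale[OF that] u(2) by (simp add: sm_def)
    finally show False by simp
  qed
  moreover have "\<Psi> f \<noteq> 0"
  proof
    assume "\<Psi> f = 0"
    then have "u (sm 1 f) = 0" using \<Psi>(3)[of 1 f] by simp
    moreover have "sm 1 f = f" unfolding sm_def by (rule blinfun_eqI) simp
    ultimately show False using u(3) by simp
  qed
  moreover obtain K where "\<And>g. norm (\<Psi> g) \<le> K * norm g"
    using bounded_linear.bounded[OF \<Psi>(1)] by (metis mult.commute)
  then have "restrict \<Psi> (dual sB) \<in> bidual sB"
    using \<Psi>(2) linear_add[OF bounded_linear.linear[OF \<Psi>(1)]]
    by (intro restrict_dual_mem_bidual) (auto simp: sm_def)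
  ultimately show ?thesis
    using f(1) by (intro bexI[of _ "restrict \<Psi> (dual sB)"]) auto
qed

section \<open>Weak convergence in the dual module\<close>

text \<open>
  Banach-Alaoglu for the net in the bidual: the evaluations at \<open>e i\<close> eventually lie in a product of
  closed balls, which is compact by Tychonoff, and \<open>G\<close> is the filter of those tails that approach a
  cluster point \<open>\<Phi>\<close>.
\<close>

lemma bounded_net_pointwise_limit:
  fixes e :: "'i \<Rightarrow> 'a::real_normed_vector" and F :: "'i filter"
  assumes F: "F \<noteq> bot" and e: "Bfun e F"
  shows "\<exists>G \<Phi> M. G \<le> F \<and> G \<noteq> bot \<and> eventually (\<lambda>i. norm (e i) \<le> M) G \<and>
    (\<forall>f :: 'a \<Rightarrow>\<^sub>L 'k::euclidean_space. ((\<lambda>i. blinfun_apply f (e i)) \<longlongrightarrow> \<Phi> f) G)"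
proof -
  obtain M where M: "eventually (\<lambda>i. norm (e i) \<le> M) F"
    using e unfolding Bfun_def by blast
  define h where "h i = (\<lambda>f :: 'a \<Rightarrow>\<^sub>L 'k. blinfun_apply f (e i))" for i
  define K where "K = (PiE UNIV (\<lambda>f :: 'a \<Rightarrow>\<^sub>L 'k. cball (0::'k) (norm f * M)))"
  have "compactin (product_topology (\<lambda>_. euclidean) UNIV) K"
    unfolding K_def by (subst compactin_PiE) auto
  then have "compact K" by (simp add: euclidean_product_topology)
  moreover have "filtermap h F \<noteq> bot" using F by (simp add: filtermap_bot_iff)
  moreover have "eventually (\<lambda>\<phi>. \<phi> \<in> K) (filtermap h F)"
    unfolding eventually_filtermap using M
  proof eventually_elim
    case (elim i)
    have "norm (blinfun_apply f (e i)) \<le> norm f * M" for f :: "'a \<Rightarrow>\<^sub>L 'k"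
      using norm_blinfun[of f "e i"] mult_left_mono[OF elim, of "norm f"] by simp
    then show ?case by (auto simp: K_def h_def)
  qed
  ultimately obtain \<Phi> where \<Phi>: "inf (nhds \<Phi>) (filtermap h F) \<noteq> bot"
    unfolding compact_filter by blast
  define G where "G = inf F (filtercomap h (nhds \<Phi>))"
  have "G \<noteq> bot"
  proof
    assume "G = bot"
    then have "eventually (\<lambda>_. False) G" by simp
    then obtain P Q where P: "eventually P F" and Q: "eventually Q (nhds \<Phi>)"
      and PQ: "\<And>i. P i \<Longrightarrow> Q (h i) \<Longrightarrow> False"
      unfolding G_def eventually_inf eventually_filtercomap by blast
    have "eventually (\<lambda>\<phi>. \<not> Q \<phi>) (filtermap h F)"
      unfolding eventually_filtermap using P by eventually_elim (use PQ in blast)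
    then have "eventually (\<lambda>_. False) (inf (nhds \<Phi>) (filtermap h F))"
      unfolding eventually_inf using Q by blast
    then show False using \<Phi> by (simp add: trivial_limit_def)
  qed
  moreover have "G \<le> F" by (simp add: G_def)
  moreover have "((\<lambda>i. blinfun_apply f (e i)) \<longlongrightarrow> \<Phi> f) G" for f
  proof -
    have "(h \<longlongrightarrow> \<Phi>) G"
      unfolding G_def by (rule filterlim_mono[OF filterlim_filtercomap order_refl inf_le2])
    then have "((\<lambda>i. h i f) \<longlongrightarrow> \<Phi> f) G"
      using continuous_on_tendsto_compose[where f="\<lambda>\<phi>. \<phi> f" and s=UNIV, OF continuous_on_product_coordinates] by simp
    then show ?thesis by (simp add: h_def)
  qed
  ultimately show ?thesis using filter_leD[OF _ M] by blast
qed

text \<open>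
  A weak-star cluster point \<open>\<Phi>\<close> of the approximate identity acts trivially, \<open>act_star2 act \<Phi> f = f\<close>, because
  \<open>act b (e i)\<close> tends to \<open>b\<close>. On elements of the algebra \<open>act_star2 act\<close> is the dual action, so continuity
  of \<open>act_star3 sB act \<Psi>\<close> at \<open>\<Phi>\<close>, evaluated at \<open>f\<close>,
  turns into convergence of \<open>\<Psi> (dual_lact act (e i) f)\<close> to \<open>\<Psi> f\<close>.
\<close>

lemma weakly_tendsto_dual_lact:
  fixes sA :: "'k::{real_normed_field,euclidean_space} \<Rightarrow> 'a::{banach,real_normed_algebra} \<Rightarrow> 'a"
    and sB :: "'k \<Rightarrow> 'b::banach \<Rightarrow> 'b" and e :: "'i \<Rightarrow> 'a"
  assumes M: "right_banach_module sA sB act" and e: "is_RBAI act e F"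
    and center: "module_center sA sB act = bidual sB"
    and f: "f \<in> dual sB"
  shows "\<exists>G. G \<noteq> bot \<and> (\<forall>\<Psi>\<in>bidual sB. ((\<lambda>i. \<Psi> (dual_lact act (e i) f)) \<longlongrightarrow> \<Psi> f) G)"
proof -
  have bb: "bounded_bilinear act" using M by (simp add: right_banach_module_def)
  have F: "F \<noteq> bot" "Bfun e F" and act_e: "\<And>b. ((\<lambda>i. act b (e i)) \<longlongrightarrow> b) F"
    using e by (auto simp: is_RBAI_def)
  obtain G \<Phi> C where G: "G \<le> F" "G \<noteq> bot" and C: "eventually (\<lambda>i. norm (e i) \<le> C) G"
    and \<Phi>: "\<And>g :: 'a \<Rightarrow>\<^sub>L 'k. ((\<lambda>i. blinfun_apply g (e i)) \<longlongrightarrow> \<Phi> g) G"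
    using bounded_net_pointwise_limit[OF F, where 'k='k] by blast
  define ev where "ev a = (\<lambda>g\<in>dual sA. blinfun_apply g a)" for a
  define \<Phi>' where "\<Phi>' = restrict \<Phi> (dual sA)"
  have ev: "ev a \<in> bidual sA" for a
    unfolding ev_def
  proof (rule restrict_dual_mem_bidual)
    show "norm (blinfun_apply g a) \<le> norm a * norm g" for g :: "'a \<Rightarrow>\<^sub>L 'k"
      using norm_blinfun[of g a] by (simp add: mult.commute)
  qed (simp_all add: blinfun.add_left)
  have \<Phi>': "\<Phi>' \<in> bidual sA"
  proof -
    have "\<Phi> (g + h) = \<Phi> g + \<Phi> h" for g h
      using tendsto_unique[OF G(2) \<Phi>[of "g + h"]] tendsto_add[OF \<Phi>[of g] \<Phi>[of h]]
      by (simp add: blinfun.add_left)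
    moreover have "\<Phi> (blinfun_mult_right c o\<^sub>L g) = c * \<Phi> g" for c g
      using tendsto_unique[OF G(2) \<Phi>[of "blinfun_mult_right c o\<^sub>L g"]]
        tendsto_mult_left[OF \<Phi>[of g], of c]
      by simp
    moreover have "norm (\<Phi> g) \<le> C * norm g" for g
    proof (rule tendsto_upperbound[OF tendsto_norm[OF \<Phi>] _ G(2)])
      show "eventually (\<lambda>i. norm (blinfun_apply g (e i)) \<le> C * norm g) G"
        using C
      proof eventually_elim
        case (elim i)
        then show ?case
          using norm_blinfun[of g "e i"] mult_left_mono[OF elim, of "norm g"] by (simp add: mult.commute)
      qed
    qed
    ultimately show ?thesis
      unfolding \<Phi>'_def by (rule restrict_dual_mem_bidual)
  qed
  have lim: "limitin (weak_star_bidual sA) (\<lambda>i. ev (e i)) \<Phi>' G"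
    unfolding weak_star_bidual_def limitin_subtopology limitin_componentwise
    using \<Phi> \<Phi>' ev by (auto simp: \<Phi>'_def ev_def bidual_def)
  have ev_act: "act_star2 act (ev a) f = dual_lact act a f" for a
    by (rule blinfun_eqI)
      (simp add: act_star2_apply[OF M f ev] dual_lact_apply[OF bb],
        simp add: ev_def act_star_mem_dual[OF M f] act_star_apply[OF bb])
  have \<Phi>_act: "act_star2 act \<Phi>' f = f"
  proof (rule blinfun_eqI)
    fix b
    have "((\<lambda>i. blinfun_apply f (act b (e i))) \<longlongrightarrow> blinfun_apply f b) G"
      by (intro blinfun.tendsto tendsto_const tendsto_mono[OF G(1) act_e])
    then have "\<Phi> (act_star act f b) = blinfun_apply f b"
      using tendsto_unique[OF G(2) \<Phi>[of "act_star act f b"]] by (simp add: act_star_apply[OF bb])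
    then show "blinfun_apply (act_star2 act \<Phi>' f) b = blinfun_apply f b"
      by (simp add: act_star2_apply[OF M f \<Phi>'], simp add: \<Phi>'_def act_star_mem_dual[OF M f])
  qed
  have "((\<lambda>i. \<Psi> (dual_lact act (e i) f)) \<longlongrightarrow> \<Psi> f) G" if "\<Psi> \<in> bidual sB" for \<Psi>
  proof -
    have "continuous_map (weak_star_bidual sA) (weak_star_bidual sB) (act_star3 sB act \<Psi>)"
      using that center unfolding module_center_def by blast
    from continuous_map_limit[OF this lim]
    have "limitin (product_topology (\<lambda>_. euclidean) (dual sB))
        (\<lambda>i. act_star3 sB act \<Psi> (ev (e i))) (act_star3 sB act \<Psi> \<Phi>') G"
      by (simp add: weak_star_bidual_def limitin_subtopology o_def)
    then have "((\<lambda>i. act_star3 sB act \<Psi> (ev (e i)) f) \<longlongrightarrow> act_star3 sB act \<Psi> \<Phi>' f) G"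
      unfolding limitin_componentwise using f by simp
    then show ?thesis by (simp add: act_star3_def f ev_act \<Phi>_act)
  qed
  with G(2) show ?thesis by blast
qed

section \<open>Factorization in the dual module\<close>

lemma closed_dual: "closed (dual s)"
proof -
  have "dual s = (\<Inter>c x. {f. blinfun_apply f (s c x) = c * blinfun_apply f x})"
    by (auto simp: dual_def)
  moreover have "closed {f. blinfun_apply f (s c x) = c * blinfun_apply f x}" for c x
    by (intro closed_Collect_eq continuous_intros)
  ultimately show ?thesis by (simp add: closed_INT)
qed

lemma subspace_dual: "subspace (dual s)"
  by (rule subspaceI)
    (simp_all add: dual_def blinfun.add_left blinfun.scaleR_left algebra_simps)

lemma bounded_bilinear_dual_lact:
  assumes "bounded_bilinear act"
  shows "bounded_bilinear (\<lambda>(f :: 'b::real_normed_vector \<Rightarrow>\<^sub>L 'k::{real_normed_field,euclidean_space}) a. dual_lact act a f)"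
proof -
  interpret act: bounded_bilinear act by (rule assms)
  obtain K where K: "K \<ge> 0" "\<And>b a. norm (act b a) \<le> norm b * norm a * K"
    using act.nonneg_bounded by blast
  note ap = dual_lact_apply[OF assms]
  show ?thesis
  proof
    show "\<exists>K. \<forall>(f :: 'b \<Rightarrow>\<^sub>L 'k) a. norm (dual_lact act a f) \<le> norm f * norm a * K"
    proof (intro exI[of _ K] allI, rule norm_blinfun_bound)
      fix f :: "'b \<Rightarrow>\<^sub>L 'k" and a b
      have "norm (blinfun_apply f (act b a)) \<le> norm f * (norm b * norm a * K)"
        using norm_blinfun[of f "act b a"] mult_left_mono[OF K(2)[of b a], of "norm f"] by simp
      then show "norm (blinfun_apply (dual_lact act a f) b) \<le> norm f * norm a * K * norm b"
        by (simp add: ap mult_ac)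
    qed (use K in simp)
  qed (rule blinfun_eqI; simp add: ap act.add_right act.scaleR_right blinfun.add_left
      blinfun.add_right blinfun.scaleR_left blinfun.scaleR_right)+
qed

text \<open>
  The usual three-epsilon argument: boundedness of the net makes the operators equicontinuous.
\<close>

lemma closed_net_fixed:
  fixes T :: "'i \<Rightarrow> 'v::real_normed_vector \<Rightarrow> 'v"
  assumes lin: "\<And>i. linear (T i)" and bd: "\<And>i v. norm (T i v) \<le> B i * norm v"
    and B: "eventually (\<lambda>i. B i \<le> C) F"
  shows "closed {v. ((\<lambda>i. T i v) \<longlongrightarrow> v) F}"
  unfolding closed_sequential_limits
proof (intro allI impI, elim conjE)
  fix w v assume w: "\<forall>n. w n \<in> {v. ((\<lambda>i. T i v) \<longlongrightarrow> v) F}" and wv: "w \<longlonglongrightarrow> v"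
  have "((\<lambda>i. T i v) \<longlongrightarrow> v) F"
  proof (rule tendstoI)
    fix \<epsilon> :: real assume \<epsilon>: "\<epsilon> > 0"
    define \<delta> where "\<delta> = \<epsilon> / (2 * (\<bar>C\<bar> + 1))"
    have \<delta>: "\<delta> > 0" using \<epsilon> by (simp add: \<delta>_def add_nonneg_pos)
    obtain n where n: "norm (w n - v) < \<delta>"
      using wv \<delta> unfolding lim_sequentially dist_norm by blast
    have "eventually (\<lambda>i. dist (T i (w n)) (w n) < \<epsilon> / 2) F"
      using w \<epsilon> by (intro tendstoD) auto
    with B show "eventually (\<lambda>i. dist (T i v) v < \<epsilon>) F"
    proof eventually_elim
      case (elim i)
      have "norm (T i (w n - v)) \<le> \<bar>C\<bar> * norm (w n - v)"
        using bd[of i "w n - v"] mult_right_mono[of "B i" "\<bar>C\<bar>" "norm (w n - v)"] elim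
          norm_ge_zero[of "w n - v"] by linarith
      then have "norm (T i (w n - v)) + norm (w n - v) \<le> (\<bar>C\<bar> + 1) * norm (w n - v)"
        by (simp add: algebra_simps)
      also have "\<dots> \<le> (\<bar>C\<bar> + 1) * \<delta>" using n by (intro mult_left_mono) auto
      also have "\<dots> = \<epsilon> / 2" by (simp add: \<delta>_def field_simps)
      finally have "norm (T i (w n - v)) + norm (w n - v) \<le> \<epsilon> / 2" .
      moreover have "T i v - v = (T i (w n) - w n) - T i (w n - v) + (w n - v)"
        by (simp add: linear_diff[OF lin])
      then have "norm (T i v - v) \<le> norm (T i (w n) - w n) + norm (T i (w n - v)) + norm (w n - v)"
        by (metis (no_types, lifting) add_right_mono norm_triangle_ineq norm_triangle_ineq4 order_trans)
      ultimately show ?case using elim by (simp add: dist_norm)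
    qed
  qed
  then show "v \<in> {v. ((\<lambda>i. T i v) \<longlongrightarrow> v) F}" by simp
qed

theorem mainTheorem6:
  fixes sA :: "'k::{real_normed_field,euclidean_space} \<Rightarrow> 'a::{banach,real_normed_algebra} \<Rightarrow> 'a"
    and sB :: "'k \<Rightarrow> 'b::banach \<Rightarrow> 'b"
    and act :: "'b \<Rightarrow> 'a \<Rightarrow> 'b"
    and e :: "'i \<Rightarrow> 'a" and F :: "'i filter"
  assumes "banach_algebra sA"
    and "right_banach_module sA sB act"
    and "is_RBAI act e F"
  shows "module_factors_left act \<and>
    (module_center sA sB act = bidual sB \<longrightarrow>
      algebra_dual_factors_right sA \<longrightarrow> dual_factors_right sB act)"
proof (intro conjI impI)
  have bb: "bounded_bilinear act" and act_act: "\<And>b x y. act (act b x) y = act b (x * y)"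
    and act_sB: "\<And>c b a. act (sB c b) a = sB c (act b a)"
    using assms(2) by (auto simp: right_banach_module_def)
  have e: "F \<noteq> bot" "Bfun e F" "\<And>a. ((\<lambda>i. a * e i) \<longlongrightarrow> a) F" "\<And>b. ((\<lambda>i. act b (e i)) \<longlongrightarrow> b) F"
    using assms(3) by (auto simp: is_RBAI_def is_RAI_def)
  interpret B: net_action act "(*)" e F UNIV
    by (rule net_action.intro) (auto simp: bb act_act e)
  show "module_factors_left act"
    unfolding module_factors_left_def using B.factorization[OF _ e(4)] by auto
  assume center: "module_center sA sB act = bidual sB" and "algebra_dual_factors_right sA"
  then obtain H :: "'a filter" where H: "H \<noteq> bot" "Bfun (\<lambda>x. x) H" "\<And>a. ((\<lambda>x. x * a) \<longlongrightarrow> a) H"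
    unfolding algebra_dual_factors_right_def has_BAI_def is_LAI_def by blast
  note ap = dual_lact_apply[OF bb]
  define lact where "lact f a = dual_lact act a f" for f :: "'b \<Rightarrow>\<^sub>L 'k" and a
  have lact_bb: "bounded_bilinear lact"
    unfolding lact_def by (rule bounded_bilinear_dual_lact[OF bb])
  have lact_lact: "lact (lact f a) b = lact f (b * a)" for f a b
    unfolding lact_def by (rule blinfun_eqI) (simp add: ap act_act)
  have lact_dual: "lact f a \<in> dual sB" if "f \<in> dual sB" for f a
    using that by (simp add: dual_def lact_def ap act_sB)
  interpret L: net_action lact "\<lambda>a b. b * a" "\<lambda>x. x" H "dual sB"
    by (rule net_action.intro) (auto simp: lact_bb lact_lact lact_dual H closed_dual subspace_dual)
  \<comment> \<open>\<open>H\<close> is the two-sided approximate identity of the algebra, unrelated to \<open>e\<close>: the factorization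
      theorem on the left module \<open>dual sB\<close> asks for a left one.\<close>
  define N where "N = {f. ((\<lambda>x. lact f x) \<longlongrightarrow> f) H}"
  have "closed N"
  proof -
    obtain C where C: "eventually (\<lambda>x. norm x \<le> C) H" using H(2) unfolding Bfun_def by blast
    obtain K where K: "K \<ge> 0" "\<And>f x. norm (lact f x) \<le> norm f * norm x * K"
      using L.act.nonneg_bounded by blast
    show ?thesis
      unfolding N_def
    proof (rule closed_net_fixed)
      show "linear (\<lambda>f. lact f x)" for x
        by (rule bounded_linear.linear[OF L.act.bounded_linear_left])
      show "norm (lact f x) \<le> (norm x * K) * norm f" for f x
        using K(2)[of f x] by (simp add: mult_ac)
      show "eventually (\<lambda>x. norm x * K \<le> C * K) H"
        using C by eventually_elim (simp add: K(1) mult_right_mono)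
    qed
  qed
  moreover have "subspace N"
  proof -
    have "lact 0 = (\<lambda>a. 0)" "\<And>f g. lact (f + g) = (\<lambda>a. lact f a + lact g a)"
      "\<And>r f. lact (r *\<^sub>R f) = (\<lambda>a. r *\<^sub>R lact f a)"
      by (auto simp: fun_eq_iff L.act.zero_left L.act.add_left L.act.scaleR_left)
    then show ?thesis
      unfolding N_def by (intro subspaceI) (auto intro!: tendsto_add tendsto_scaleR)
  qed
  moreover have "blinfun_mult_right c o\<^sub>L g \<in> N" if "g \<in> N" for c g
  proof -
    have "lact (blinfun_mult_right c o\<^sub>L g) = (\<lambda>x. blinfun_mult_right c o\<^sub>L lact g x)"
      unfolding lact_def by (intro ext blinfun_eqI) (simp add: ap)
    then show ?thesis
      using that bounded_bilinear.tendsto[OF bounded_bilinear_blinfun_compose tendsto_const[of "blinfun_mult_right c"], of "lact g" g H]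
      unfolding N_def by (simp only: mem_Collect_eq)
  qed
  moreover have lactN: "lact f a \<in> N" for f a
  proof -
    have "((\<lambda>x. lact f (x * a)) \<longlongrightarrow> lact f a) H" by (rule L.act.tendsto[OF tendsto_const H(3)])
    moreover have "lact (lact f a) = (\<lambda>x. lact f (x * a))" by (rule ext) (rule lact_lact)
    ultimately show ?thesis by (simp add: N_def)
  qed
  ultimately have "f \<in> N" if f: "f \<in> dual sB" for f
  proof (rule_tac ccontr)
    assume "f \<notin> N"
    with \<open>closed N\<close> \<open>subspace N\<close> \<open>\<And>g c. g \<in> N \<Longrightarrow> blinfun_mult_right c o\<^sub>L g \<in> N\<close> f
    obtain \<Psi> where \<Psi>: "\<Psi> \<in> bidual sB" "\<And>g. g \<in> N \<Longrightarrow> g \<in> dual sB \<Longrightarrow> \<Psi> g = 0" "\<Psi> f \<noteq> 0"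
      using bidual_separation[of N f sB] by blast
    obtain G where G: "G \<noteq> bot" "((\<lambda>i. \<Psi> (dual_lact act (e i) f)) \<longlongrightarrow> \<Psi> f) G"
      using weakly_tendsto_dual_lact[OF assms(2,3) center f] \<Psi>(1) by blast
    have "\<Psi> (dual_lact act a f) = 0" for a
      using \<Psi>(2)[OF lactN lact_dual[OF f], of a] by (simp add: lact_def)
    then have "((\<lambda>i. 0) \<longlongrightarrow> \<Psi> f) G" using G(2) by simp
    then show False using \<Psi>(3) G(1) by (simp add: tendsto_const_iff)
  qed
  then have "\<exists>g\<in>dual sB. \<exists>a. f = dual_lact act a g" if "f \<in> dual sB" for f
    using L.factorization[OF that] that unfolding N_def lact_def by blast
  moreover have "dual_lact act a f \<in> dual sB" if "f \<in> dual sB" for f a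
    using lact_dual[OF that] by (simp only: lact_def)
  ultimately show "dual_factors_right sB act"
    unfolding dual_factors_right_def by blast
qed

end
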